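(* Let $k,a\in\mathbb{N}$ and $k>a$. Then $$\left\langle (e^t-1)^k \;\middle|\; {}_H\beta_n^{(a)}(x,v)\right\rangle=\sum_{m=0}^\infty\frac{(-v)^{2m}\,(k-a)!\,(n)_{2m+a}}{m!\,2^m}\,S(n-2m-a,\,k-a),$$ where $S(n-2m-a,k-a)$ denotes the Stirling numbers of the second kind.
   Context: $\mathbb{N}=\{1,2,3,\dots\}$, $n\in\mathbb{N}_0=\mathbb{N}\cup\{0\}$, and $v$ is a parameter; the base field is $\mathbb{C}$. The polynomials ${}_H\beta_n^{(a)}(x,v)$ in $x$ are defined by the generating function $$\left(\frac{t}{e^t-1}\right)^a e^{xt-\frac{v t^2}{2}}=\sum_{n=0}^\infty {}_H\beta_n^{(a)}(x,v)\frac{t^n}{n!}.$$ A formal power series $f(t)=\sum_{k\ge0}\frac{a_k}{k!}t^k$ over $\mathbb{C}$ defines a linear functional on the polynomials in $x$ by $\langle f(t)\mid x^k\rangle=a_k$ for all $k\ge0$; $\langle f(t)\mid p(x)\rangle$ denotes its value on a polynomial $p(x)$. The falling factorial is $(x)_b=x(x-1)\cdots(x-b+1)$ for $b\in\mathbb{N}$. The Stirling numbers of the second kind satisfy $S(n,k)=\frac{1}{k!}\langle (e^t-1)^k\mid x^n\rangle$.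
   Formalization: The factor (-v)^{2m} in the sum is corrected to (-v)^m; as printed the identity fails, e.g. for a=1, k=2, n=4, where the left side is 4-12v and the printed right side is 4+12v^2. *)

theory Defs
  imports
    Complex_Main
    "HOL-Computational_Algebra.Computational_Algebra"
    "HOL-Combinatorics.Stirling"
begin

(* The functional with t^k / k! acting on x^k as 1: its value on x^k is a_k, where
   f = (\<Sum>k. (a_k / k!) t^k), hence the factor fact k. *)
definition umbral :: "complex fps \<Rightarrow> complex poly \<Rightarrow> complex" where
  "umbral f p = (\<Sum>k\<le>degree p. fact k * fps_nth f k * coeff p k)"

definition falling_fact :: "'a::comm_ring_1 \<Rightarrow> nat \<Rightarrow> 'a" where
  "falling_fact x b = (\<Prod>i<b. x - of_nat i)"

(* The embedding of C[[t]] into C[x][[t]]. *)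
definition fps_poly_lift :: "complex fps \<Rightarrow> complex poly fps" where
  "fps_poly_lift f = Abs_fps (\<lambda>n. [:fps_nth f n:])"

(* (t / (e^t - 1))^a e^(xt - v t^2 / 2) as an element of C[x][[t]]; [:0, 1:] is x. *)
definition hermite_bernoulli_gf :: "nat \<Rightarrow> complex \<Rightarrow> complex poly fps" where
  "hermite_bernoulli_gf a v =
     fps_poly_lift ((fps_X / (fps_exp 1 - 1)) ^ a) *
     (fps_poly_lift (fps_exp 1) oo
        (fps_const [:0, 1:] * fps_X - fps_const [:v / 2:] * fps_X ^ 2))"

definition hermite_bernoulli :: "nat \<Rightarrow> nat \<Rightarrow> complex \<Rightarrow> complex poly" where
  "hermite_bernoulli a n v = smult (fact n) (fps_nth (hermite_bernoulli_gf a v) n)"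

lemma umbral_bound:
  assumes "degree p \<le> N"
  shows "umbral f p = (\<Sum>k\<le>N. fact k * fps_nth f k * coeff p k)"
  unfolding umbral_def
  by (rule sum.mono_neutral_left) (use assms in \<open>auto simp: coeff_eq_0\<close>)

lemma umbral_add: "umbral f (p + q) = umbral f p + umbral f q"
proof -
  define N where "N = max (degree p) (degree q)"
  have "degree (p + q) \<le> N" "degree p \<le> N" "degree q \<le> N"
    by (auto simp: N_def degree_add_le_max)
  then show ?thesis
    by (simp add: umbral_bound[of _ N] algebra_simps sum.distrib)
qed

lemma umbral_smult: "umbral f (smult c p) = c * umbral f p"
  by (simp add: umbral_bound[of _ "degree p"] degree_smult_le sum_distrib_left algebra_simps)

lemma umbral_monom:
  "umbral (Abs_fps (\<lambda>j. a j / fact j)) (monom 1 k) = a k"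
  by (simp add: umbral_bound[of _ k] degree_monom_le if_distrib cong: if_cong)

lemma hermite_bernoulli_generating_function:
  "(fps_X / (fps_exp 1 - 1)) ^ a *
     (fps_exp 1 oo (fps_const x * fps_X - fps_const (v / 2) * fps_X ^ 2)) =
   Abs_fps (\<lambda>n. poly (hermite_bernoulli a n v) x / fact n)"
proof -
  define ev :: "complex poly fps \<Rightarrow> complex fps" where
    "ev F = Abs_fps (\<lambda>n. poly (fps_nth F n) x)" for F
  have mult: "ev (F * G) = ev F * ev G" for F G
    by (simp add: ev_def fps_eq_iff fps_mult_nth poly_sum)
  have one: "ev 1 = 1"
    by (simp add: ev_def fps_eq_iff)
  have power: "ev (F ^ n) = ev F ^ n" for F n
    by (induction n) (simp_all add: one mult)
  have compose: "ev (F oo G) = ev F oo ev G" for F G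
    unfolding fps_eq_iff fps_compose_nth power[symmetric]
    by (simp add: ev_def fps_compose_nth poly_sum)
  have lift: "ev (fps_poly_lift f) = f" for f
    by (simp add: ev_def fps_poly_lift_def fps_eq_iff)
  have "ev (fps_const [:0, 1:] * fps_X - fps_const [:v / 2:] * fps_X ^ 2) =
      fps_const x * fps_X - fps_const (v / 2) * fps_X ^ 2"
    by (simp add: ev_def fps_eq_iff fps_X_power_iff)
  then have "ev (hermite_bernoulli_gf a v) = (fps_X / (fps_exp 1 - 1)) ^ a *
     (fps_exp 1 oo (fps_const x * fps_X - fps_const (v / 2) * fps_X ^ 2))"
    by (simp add: hermite_bernoulli_gf_def mult compose lift)
  moreover have "ev (hermite_bernoulli_gf a v) =
      Abs_fps (\<lambda>n. poly (hermite_bernoulli a n v) x / fact n)"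
    by (simp add: ev_def hermite_bernoulli_def fps_eq_iff)
  ultimately show ?thesis by simp
qed

end

theory Submission
  imports Defs
begin

text \<open>
  Since the functional of \<open>f\<close> sends \<open>e\<^sup>x\<^sup>t\<close> to \<open>f(t)\<close>, it sends the generating function of the
  polynomials to \<open>f(t) (t / (e\<^sup>t - 1))\<^sup>a e\<^bsup>-vt\<^sup>2/2\<^esup>\<close>. For \<open>f(t) = (e\<^sup>t - 1)\<^sup>k\<close> this product is
  \<open>t\<^sup>a (e\<^sup>t - 1)\<^bsup>k-a\<^esup> e\<^bsup>-vt\<^sup>2/2\<^esup>\<close>, and the claim is the comparison of coefficients of \<open>t\<^sup>n\<close>.
\<close>

text \<open>With E = e^t - 1, E' = E + 1 gives (E^(p+1))' = (p+1) (E^(p+1) + E^p); on coefficients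
  this is the recurrence defining \<open>Stirling\<close>.\<close>

lemma fps_exp_minus_1_power_nth:
  "fps_nth ((fps_exp 1 - 1 :: complex fps) ^ q) j = fact q * of_nat (Stirling j q) / fact j"
proof (induction j arbitrary: q)
  case 0
  show ?case by (cases q) (auto simp: fps_nth_power_0)
next
  case (Suc j)
  show ?case
  proof (cases q)
    case 0
    then show ?thesis by simp
  next
    case (Suc p)
    let ?E = "fps_exp 1 - 1 :: complex fps"
    have "fps_deriv (?E ^ Suc p) = of_nat (Suc p) * (?E ^ Suc p + ?E ^ p)"
      unfolding fps_deriv_power' by (simp add: algebra_simps)
    then have "fps_nth (fps_deriv (?E ^ Suc p)) j
        = of_nat (Suc p) * (fps_nth (?E ^ Suc p) j + fps_nth (?E ^ p) j)"
      by (simp only: fps_of_nat[symmetric] fps_mult_left_const_nth fps_add_nth)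
    also have "\<dots> = of_nat (Suc p) *
        (fact (Suc p) * of_nat (Stirling j (Suc p)) / fact j
          + fact p * of_nat (Stirling j p) / fact j)"
      by (simp only: Suc.IH)
    also have "\<dots> = fact (Suc p) * of_nat (Stirling (Suc j) (Suc p)) / fact j"
      by (simp add: field_simps)
    finally show ?thesis
      unfolding Suc by (simp add: field_simps del: power_Suc Stirling.simps of_nat_Suc)
  qed
qed

lemma fps_ode_unique:
  fixes F G h :: "complex fps"
  assumes F: "fps_deriv F = h * F" and G: "fps_deriv G = h * G"
    and eq0: "fps_nth F 0 = fps_nth G 0"
  shows "F = G"
proof -
  define D where "D = F - G"
  have D: "fps_deriv D = h * D"
    by (simp add: D_def F G algebra_simps)
  have "fps_nth D n = 0" for n
  proof (induction n rule: less_induct)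
    case (less n)
    show ?case
    proof (cases n)
      case 0
      then show ?thesis by (simp add: D_def eq0)
    next
      case (Suc m)
      have "of_nat (Suc m) * fps_nth D (Suc m) = fps_nth (h * D) m"
        by (simp add: D[symmetric])
      also have "\<dots> = 0"
        \<comment> \<open>Coefficient m of h D involves only D_0, ..., D_m, all zero by
          induction.\<close>
        unfolding fps_mult_nth by (rule sum.neutral) (auto simp: less.IH Suc)
      finally show ?thesis
        using Suc by (simp del: of_nat_Suc)
    qed
  qed
  then show ?thesis
    by (simp add: D_def fps_eq_iff)
qed

text \<open>Both sides solve F' = (A + B)' F with constant term 1. The vanishing constant terms of A
  and B make the chain rule for composition available.\<close>

lemma fps_exp_compose_add:
  fixes A B :: "complex fps"
  assumes "fps_nth A 0 = 0" and "fps_nth B 0 = 0"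
  shows "fps_exp 1 oo (A + B) = (fps_exp 1 oo A) * (fps_exp 1 oo B)"
  by (rule fps_ode_unique[where h = "fps_deriv (A + B)"])
    (simp_all add: fps_compose_deriv assms algebra_simps)

lemma fps_exp_compose_square_nth:
  fixes c :: complex
  shows "fps_nth (fps_exp 1 oo (fps_const c * fps_X ^ 2)) i
    = (if even i then c ^ (i div 2) / fact (i div 2) else 0)"
proof -
  have "fps_nth ((fps_const c * fps_X ^ 2) ^ m) i = (if i = 2 * m then c ^ m else 0)" for m
    by (simp add: power_mult_distrib power_mult[symmetric] del: fps_const_mult_apply_left)
  then have "fps_nth (fps_exp 1 oo (fps_const c * fps_X ^ 2)) i
      = (\<Sum>m=0..i. if i = 2 * m then c ^ m / fact m else 0)"
    by (auto simp: fps_compose_nth intro!: sum.cong)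
  also have "\<dots> = (if even i then c ^ (i div 2) / fact (i div 2) else 0)"
    by (cases "even i") (auto elim!: evenE intro!: sum.neutral)
  finally show ?thesis .
qed

lemma fps_exp_compose_square_mult_nth:
  fixes c :: complex
  shows "fps_nth ((fps_exp 1 oo (fps_const c * fps_X ^ 2)) * g) n
    = (\<Sum>m | 2 * m \<le> n. c ^ m / fact m * fps_nth g (n - 2 * m))"
proof -
  let ?H = "fps_exp 1 oo (fps_const c * fps_X ^ 2)"
  have "fps_nth (?H * g) n = (\<Sum>i=0..n. fps_nth ?H i * fps_nth g (n - i))"
    by (rule fps_mult_nth)
  also have "\<dots> = (\<Sum>i\<in>(*) 2 ` {m. 2 * m \<le> n}. fps_nth ?H i * fps_nth g (n - i))"
    \<comment> \<open>The odd coefficients of the Gaussian factor vanish, so only i = 2m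
      survives.\<close>
    by (rule sum.mono_neutral_right) (auto simp: fps_exp_compose_square_nth elim!: evenE)
  also have "\<dots> = (\<Sum>m | 2 * m \<le> n. fps_nth ?H (2 * m) * fps_nth g (n - 2 * m))"
    by (subst sum.reindex) (auto simp: inj_on_def)
  finally show ?thesis
    by (simp add: fps_exp_compose_square_nth)
qed

lemma umbral_sum: "umbral f (\<Sum>i\<in>I. p i) = (\<Sum>i\<in>I. umbral f (p i))"
proof (induction I rule: infinite_finite_induct)
  case (insert i I)
  then show ?case by (simp add: umbral_add)
qed (simp_all add: umbral_def)

lemma umbral_monom_fact: "umbral f (monom c j) = fact j * c * fps_nth f j"
  by (simp add: umbral_bound[of _ j] degree_monom_le if_distrib cong: if_cong)

text \<open>With h the factor free of x, the polynomial is n! times the sum of h_i x^(n-i) / (n-i)!.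
  The functional replaces x^j / j! by the coefficient f_j, which leaves the Cauchy product of h and
  f.\<close>

lemma umbral_hermite_bernoulli:
  "umbral f (hermite_bernoulli a n v) = fact n * fps_nth
     ((fps_X / (fps_exp 1 - 1)) ^ a * (fps_exp 1 oo (fps_const (- v / 2) * fps_X ^ 2)) * f) n"
proof -
  define h where
    "h = (fps_X / (fps_exp 1 - 1)) ^ a * (fps_exp 1 oo (fps_const (- v / 2) * fps_X ^ 2))"
  \<comment> \<open>The generating function is evaluated at each complex x; equal values everywhere
    then give equal polynomials.\<close>
  have "poly (hermite_bernoulli a n v) x
      = poly (\<Sum>i=0..n. monom (fact n * fps_nth h i / fact (n - i)) (n - i)) x" for x
  proof -
    have split: "fps_const x * fps_X - fps_const (v / 2) * fps_X ^ 2
        = fps_const x * fps_X + fps_const (- v / 2) * fps_X ^ 2"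
      by (simp flip: fps_const_neg)
    have "Abs_fps (\<lambda>n. poly (hermite_bernoulli a n v) x / fact n) = h * fps_exp x"
      unfolding hermite_bernoulli_generating_function[symmetric] split
      by (simp add: fps_exp_compose_add h_def mult.assoc)
    then have "poly (hermite_bernoulli a n v) x / fact n = fps_nth (h * fps_exp x) n"
      by (metis fps_nth_Abs_fps)
    then show ?thesis
      by (simp add: fps_mult_nth poly_sum poly_monom field_simps sum_distrib_left)
  qed
  then have "hermite_bernoulli a n v
      = (\<Sum>i=0..n. monom (fact n * fps_nth h i / fact (n - i)) (n - i))"
    by (simp add: poly_eq_poly_eq_iff[symmetric] fun_eq_iff)
  then show ?thesis
    unfolding h_def[symmetric]
    by (simp add: umbral_sum umbral_monom_fact fps_mult_nth sum_distrib_left mult.assoc)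
qed

lemma falling_fact_of_nat:
  assumes "b \<le> n"
  shows "falling_fact (of_nat n :: complex) b = fact n / fact (n - b)"
  using assms
proof (induction b)
  case (Suc b)
  then have "n - b = Suc (n - Suc b)" by simp
  then have "fact (n - b) = (of_nat n - of_nat b) * (fact (n - Suc b) :: complex)"
    using Suc.prems by (simp add: of_nat_diff)
  with Suc show ?case
    by (simp add: falling_fact_def of_nat_diff)
qed (simp add: falling_fact_def)

lemma falling_fact_of_nat_eq_0:
  assumes "n < b"
  shows "falling_fact (of_nat n :: complex) b = 0"
  unfolding falling_fact_def using assms by (auto intro!: prod_zero bexI[of _ n])

text \<open>The exponent of -v is m, not 2m, because the coefficient of t^(2m) in e^(-v t^2/2) is
  (-v/2)^m / m!. Truncated subtraction in \<open>n - 2 * m - a\<close> does no harm: if 2m + a > n,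
  the falling factorial is zero.\<close>

theorem theorem6:
  fixes k a n :: nat and v :: complex
  assumes "k \<ge> 1" and "a \<ge> 1" and "k > a"
  shows "(\<lambda>m. (- v) ^ m * fact (k - a) * falling_fact (of_nat n) (2 * m + a) / (fact m * 2 ^ m)
              * of_nat (Stirling (n - 2 * m - a) (k - a)))
         sums umbral ((fps_exp 1 - 1) ^ k) (hermite_bernoulli a n v)"
    (is "?s sums _")
proof -
  let ?E = "fps_exp 1 - 1 :: complex fps"
  let ?H = "fps_exp 1 oo (fps_const (- v / 2) * fps_X ^ 2)"
  \<comment> \<open>Division of power series inverts multiplication only under divisibility; e^t - 1
    has order 1, hence divides t.\<close>
  have "subdegree ?E = 1"
    by (rule subdegreeI) auto
  then have "?E dvd fps_X"
    by (subst fps_dvd_iff) auto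
  then have "fps_X / ?E * ?E = fps_X"
    by simp
  then have "(fps_X / ?E) ^ a * ?E ^ a = fps_X ^ a"
    by (simp flip: power_mult_distrib)
  moreover have "?E ^ k = ?E ^ a * ?E ^ (k - a)"
    using assms by (simp flip: power_add)
  moreover have "(fps_X / ?E) ^ a * ?H * (?E ^ a * ?E ^ (k - a))
      = ?H * ((fps_X / ?E) ^ a * ?E ^ a * ?E ^ (k - a))"
    by (simp only: mult_ac)
  ultimately have "(fps_X / ?E) ^ a * ?H * ?E ^ k = ?H * (fps_X ^ a * ?E ^ (k - a))"
    by (simp only:)
  then have "umbral (?E ^ k) (hermite_bernoulli a n v)
      = (\<Sum>m | 2 * m \<le> n. fact n * ((- v / 2) ^ m / fact m
          * fps_nth (fps_X ^ a * ?E ^ (k - a)) (n - 2 * m)))"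
    by (simp only: umbral_hermite_bernoulli fps_exp_compose_square_mult_nth sum_distrib_left)
  also have "\<dots> = (\<Sum>m | 2 * m \<le> n. ?s m)"
  proof (rule sum.cong)
    fix m assume "m \<in> {m. 2 * m \<le> n}"
    then show "fact n * ((- v / 2) ^ m / fact m
        * fps_nth (fps_X ^ a * ?E ^ (k - a)) (n - 2 * m)) = ?s m"
      unfolding power_divide
      \<comment> \<open>If 2m + a > n, both sides vanish: the left because t^a has no coefficient
        below degree a, the right through the factor i = n of the falling factorial.\<close>
      by (cases "2 * m + a \<le> n")
        (auto simp: fps_X_power_mult_nth fps_exp_minus_1_power_nth falling_fact_of_nat
          falling_fact_of_nat_eq_0 field_simps)
  qed simp
  finally have "umbral (?E ^ k) (hermite_bernoulli a n v) = (\<Sum>m | 2 * m \<le> n. ?s m)" .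
  moreover have "finite {m. 2 * m \<le> n}"
    by (rule finite_subset[of _ "{..n}"]) auto
  \<comment> \<open>The same vanishing kills every term with 2m > n, so the infinite series is a
    finite sum.\<close>
  then have "?s sums (\<Sum>m | 2 * m \<le> n. ?s m)"
    by (rule sums_finite) (simp add: falling_fact_of_nat_eq_0)
  ultimately show ?thesis by simp
qed

end
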